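(* Let $\mathcal{X},\mathcal{Y},\mathcal{Z}$ be subspaces of $\mathcal{H}$. The following are equivalent: (i) there exists an idempotent linear relation $F$ on $\mathcal{H}$ such that $\mathcal{X}=\operatorname{ran}F$, $\mathcal{Y}=\operatorname{ran}(I-F)$ and $\mathcal{Z}=\operatorname{dom}F$; (ii) $(\mathcal{X}\cap\mathcal{Y})+\mathcal{Z}=\mathcal{X}+\mathcal{Y}$; (iii) $\mathcal{X}=(\mathcal{X}\cap\mathcal{Y})+(\mathcal{X}\cap\mathcal{Z})$ and $\mathcal{X}+\mathcal{Y}=\mathcal{X}+\mathcal{Z}$. In this case, $F=P_{\mathcal{X},\mathcal{Y}}\cap(\mathcal{Z}\times\mathcal{H})$ is the unique idempotent linear relation satisfying the conditions in (i).
   Context: $\mathcal{H}$ is a complex separable Hilbert space; "subspace" means linear subspace, not necessarily closed. A linear relation on $\mathcal{H}$ is a linear subspace $F \subseteq \mathcal{H}\times\mathcal{H}$, with $\operatorname{dom}F=\{x:(x,y)\in F \text{ for some } y\}$, $\operatorname{ran}F=\{y:(x,y)\in F\text{ for some }x\}$. Product: $ST=\{(x,y): (x,z)\in T,\ (z,y)\in S \text{ for some } z\}$, and $F^2=FF$. $F$ is idempotent if $F^2=F$. $I=\{(u,u):u\in\mathcal{H}\}$ and $I-F=\{(x,x-y):(x,y)\in F\}$. For subspaces $\mathcal{M},\mathcal{N}$ of $\mathcal{H}$, $P_{\mathcal{M},\mathcal{N}}:=\{(m+n,m): m\in\mathcal{M},\ n\in\mathcal{N}\}$ (a linear relation). 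*)

theory Defs
  imports "HOL-Analysis.Analysis" "HOL-Library.Set_Algebras"
begin

class scaleC =
  fixes scaleC :: "complex \<Rightarrow> 'a \<Rightarrow> 'a"  (infixr \<open>*\<^sub>C\<close> 75)

class complex_vector = scaleC + ab_group_add +
  assumes scaleC_add_right: "a *\<^sub>C (x + y) = a *\<^sub>C x + a *\<^sub>C y"
    and scaleC_add_left: "(a + b) *\<^sub>C x = a *\<^sub>C x + b *\<^sub>C x"
    and scaleC_scaleC: "a *\<^sub>C b *\<^sub>C x = (a * b) *\<^sub>C x"
    and scaleC_one: "1 *\<^sub>C x = x"

global_interpretation complex_vector:
  vector_space "scaleC :: complex \<Rightarrow> 'a \<Rightarrow> 'a::complex_vector"
  by unfold_locales
    (simp_all add: scaleC_add_right scaleC_add_left scaleC_scaleC scaleC_one)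

instantiation prod :: (complex_vector, complex_vector) complex_vector
begin

definition scaleC_prod :: "complex \<Rightarrow> 'a \<times> 'b \<Rightarrow> 'a \<times> 'b"
  where "scaleC_prod c p = (c *\<^sub>C fst p, c *\<^sub>C snd p)"

instance
  by standard
    (simp_all add: scaleC_prod_def prod_eq_iff scaleC_add_right scaleC_add_left
      scaleC_scaleC scaleC_one)

end

text \<open>The inner product is linear in its first argument. The real normed structure
  is required to be the one induced by the complex scaling and the inner product.\<close>

class complex_inner = complex_vector + real_normed_vector +
  fixes cinner :: "'a \<Rightarrow> 'a \<Rightarrow> complex"
  assumes scaleR_eq_scaleC: "r *\<^sub>R x = complex_of_real r *\<^sub>C x"
    and cinner_commute: "cinner x y = cnj (cinner y x)"
    and cinner_add_left: "cinner (x + y) z = cinner x z + cinner y z"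
    and cinner_scaleC_left: "cinner (c *\<^sub>C x) y = c * cinner x y"
    and cinner_ge_zero: "0 \<le> Re (cinner x x)"
    and cinner_eq_zero_iff: "cinner x x = 0 \<longleftrightarrow> x = 0"
    and norm_eq_sqrt_cinner: "norm x = sqrt (Re (cinner x x))"

class separable_complex_hilbert_space = complex_inner + complete_space +
  assumes separable: "\<exists>D :: 'a set. countable D \<and> (\<forall>x. \<forall>e>0. \<exists>d\<in>D. dist d x < e)"

instantiation complex :: separable_complex_hilbert_space
begin

definition scaleC_complex :: "complex \<Rightarrow> complex \<Rightarrow> complex"
  where "scaleC_complex c x = c * x"

definition cinner_complex :: "complex \<Rightarrow> complex \<Rightarrow> complex"
  where "cinner_complex x y = x * cnj y"

instance
proof
  show "\<exists>D :: complex set. countable D \<and> (\<forall>x. \<forall>e>0. \<exists>d\<in>D. dist d x < e)"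
  proof -
    obtain D :: "complex set" where "countable D"
      and D: "\<And>S. open S \<Longrightarrow> S \<noteq> {} \<Longrightarrow> \<exists>d \<in> D. d \<in> S"
      using countable_dense_exists by blast
    moreover have "\<exists>d\<in>D. dist d x < e" if "e > 0" for x e
      using D[of "ball x e"] that by (auto simp: dist_commute)
    ultimately show ?thesis by blast
  qed
qed (auto simp: scaleC_complex_def cinner_complex_def algebra_simps scaleR_conv_of_real
  cmod_def power2_eq_square)

end

definition linear_relation :: "('a::complex_vector \<times> 'a) set \<Rightarrow> bool"
  where "linear_relation F \<longleftrightarrow> complex_vector.subspace F"

text \<open>Composition of relations is diagrammatic in the library, so the product
  \<open>ST\<close> of linear relations (first \<open>T\<close>, then \<open>S\<close>) is \<open>T O S\<close>.\<close>

definition rel_product ::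
  "('a \<times> 'a) set \<Rightarrow> ('a \<times> 'a) set \<Rightarrow> ('a \<times> 'a) set"  (infixl \<open>\<cdot>\<^sub>r\<close> 75)
  where "S \<cdot>\<^sub>r T = T O S"

definition idempotent_linear_relation :: "('a::complex_vector \<times> 'a) set \<Rightarrow> bool"
  where "idempotent_linear_relation F \<longleftrightarrow> linear_relation F \<and> F \<cdot>\<^sub>r F = F"

definition id_minus_rel :: "('a::complex_vector \<times> 'a) set \<Rightarrow> ('a \<times> 'a) set"
  where "id_minus_rel F = {(x, x - y) | x y. (x, y) \<in> F}"

definition P_rel :: "'a::complex_vector set \<Rightarrow> 'a set \<Rightarrow> ('a \<times> 'a) set"
  where "P_rel M N = {(m + n, m) | m n. m \<in> M \<and> n \<in> N}"

end

theory Submission imports Defs begin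

text \<open>If \<open>F\<close> is idempotent, factoring \<open>(u, x) \<in> F\<close> through some \<open>z\<close> gives \<open>(z, z) \<in> F\<close> with
  \<open>x - z\<close> in the multivalued part of \<open>F\<close>; hence that part is exactly \<open>ran F \<inter> ran (I - F)\<close>.
  Consequently \<open>F\<close> is determined by its domain and the two ranges.\<close>

section \<open>Membership rules for linear relations\<close>

lemma linear_relation_diff:
  assumes "linear_relation F" "(a, b) \<in> F" "(c, d) \<in> F"
  shows "(a - c, b - d) \<in> F"
  using complex_vector.subspace_diff[of F "(a, b)" "(c, d)"] assms
  by (simp add: linear_relation_def)

lemma linear_relation_add:
  assumes "linear_relation F" "(a, b) \<in> F" "(c, d) \<in> F"
  shows "(a + c, b + d) \<in> F"
  using complex_vector.subspace_add[of F "(a, b)" "(c, d)"] assms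
  by (simp add: linear_relation_def)

lemma idempotent_iff:
  assumes "idempotent_linear_relation F"
  shows "(a, b) \<in> F \<longleftrightarrow> (\<exists>c. (a, c) \<in> F \<and> (c, b) \<in> F)"
proof -
  have "F = F O F"
    using assms by (simp add: idempotent_linear_relation_def rel_product_def)
  then show ?thesis by blast
qed

lemma Range_id_minus_rel_iff: "y \<in> Range (id_minus_rel F) \<longleftrightarrow> (\<exists>a. (a, a - y) \<in> F)"
proof
  assume "y \<in> Range (id_minus_rel F)"
  then obtain a b where "(a, b) \<in> F" "y = a - b"
    by (auto simp: id_minus_rel_def)
  then have "(a, a - y) \<in> F" by simp
  then show "\<exists>a. (a, a - y) \<in> F" ..
next
  assume "\<exists>a. (a, a - y) \<in> F"
  then obtain a where "(a, a - y) \<in> F" ..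
  then have "(a, a - (a - y)) \<in> id_minus_rel F"
    unfolding id_minus_rel_def by blast
  then show "y \<in> Range (id_minus_rel F)" by auto
qed

text \<open>The second component forces \<open>m = b\<close>, hence \<open>n = a - b\<close>, so no
  existential remains.\<close>

lemma mem_P_rel_iff: "(a, b) \<in> P_rel M N \<longleftrightarrow> b \<in> M \<and> a - b \<in> N"
proof
  assume "b \<in> M \<and> a - b \<in> N"
  then have "(b + (a - b), b) \<in> P_rel M N"
    unfolding P_rel_def by blast
  then show "(a, b) \<in> P_rel M N" by simp
qed (auto simp: P_rel_def)

lemma linear_relation_P_rel:
  assumes "complex_vector.subspace M" "complex_vector.subspace N"
  shows "linear_relation (P_rel M N)"
  unfolding linear_relation_def complex_vector.subspace_def
proof (intro conjI ballI allI)
  show "0 \<in> P_rel M N"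
    using assms by (simp add: zero_prod_def mem_P_rel_iff complex_vector.subspace_0)
next
  fix p q assume "p \<in> P_rel M N" "q \<in> P_rel M N"
  then show "p + q \<in> P_rel M N"
    using assms
    by (cases p; cases q)
      (simp add: mem_P_rel_iff complex_vector.subspace_add add_diff_add)
next
  fix c p assume "p \<in> P_rel M N"
  then show "c *\<^sub>C p \<in> P_rel M N"
    using assms
    by (cases p)
      (simp add: scaleC_prod_def mem_P_rel_iff complex_vector.subspace_scale
        complex_vector.scale_right_diff_distrib[symmetric])
qed

lemma subspace_Times_UNIV:
  assumes "complex_vector.subspace Z"
  shows "complex_vector.subspace (Z \<times> UNIV)"
  using assms
  by (auto simp: complex_vector.subspace_def zero_prod_def scaleC_prod_def)

section \<open>Structure of an idempotent relation\<close>

lemma idempotent_range_decomp: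
  assumes F: "idempotent_linear_relation F" and "(u, x) \<in> F"
  obtains z where "(u, z) \<in> F" "(z, z) \<in> F" "(0, x - z) \<in> F"
proof -
  have lin: "linear_relation F"
    using F by (simp add: idempotent_linear_relation_def)
  obtain z where z: "(u, z) \<in> F" "(z, x) \<in> F"
    using assms idempotent_iff by blast
  have m: "(0, x - z) \<in> F"
    using linear_relation_diff[OF lin \<open>(u, x) \<in> F\<close> z(1)] by simp
  have "(z, z) \<in> F"
    using linear_relation_diff[OF lin z(2) m] by simp
  with z(1) m show thesis by (intro that)
qed

lemma idempotent_mul_eq:
  assumes F: "idempotent_linear_relation F"
  shows "(0, w) \<in> F \<longleftrightarrow> w \<in> Range F \<inter> Range (id_minus_rel F)"
proof
  have lin: "linear_relation F"
    using F by (simp add: idempotent_linear_relation_def)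
  note diff = linear_relation_diff[OF lin]
  have "(0, 0) \<in> F"
    using lin complex_vector.subspace_0 by (simp add: linear_relation_def flip: zero_prod_def)
  note minus = diff[OF this]
  {
    assume w: "(0, w) \<in> F"
    \<comment> \<open>By linearity \<open>- w\<close> is also a value at 0, and
      \<open>w = 0 - (- w)\<close> is then a value of I - F.\<close>
    then show "w \<in> Range F \<inter> Range (id_minus_rel F)"
      using minus[OF w] by (auto simp: Range_id_minus_rel_iff intro!: exI[of _ 0])
  }
  assume w: "w \<in> Range F \<inter> Range (id_minus_rel F)"
  then obtain u where "(u, w) \<in> F" by blast
  then obtain z where z: "(z, z) \<in> F" "(0, w - z) \<in> F"
    using idempotent_range_decomp[OF F] by blast
  from w obtain a where a: "(a, a - w) \<in> F"
    by (auto simp: Range_id_minus_rel_iff)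
  then obtain b where b: "(a, b) \<in> F" "(b, b) \<in> F" "(0, a - w - b) \<in> F"
    using idempotent_range_decomp[OF F] by blast
  \<comment> \<open>With \<open>e = a - b\<close> in the kernel, \<open>z - e\<close> is a multivalued element that \<open>F\<close> relates to \<open>z\<close>.\<close>
  have "(z - (a - b), z) \<in> F"
    using diff[OF z(1) diff[OF b(1,2)]] by simp
  \<comment> \<open>The multivalued elements \<open>w - z\<close> and \<open>a - w - b\<close> add
    up to \<open>(a - b) - z\<close>, in which \<open>w\<close> cancels.\<close>
  moreover have "(0, z - (a - b)) \<in> F"
    using minus[OF linear_relation_add[OF lin z(2) b(3)]] by (simp add: algebra_simps)
  ultimately have "(0, z) \<in> F"
    using idempotent_iff[OF F] by blast
  then show "(0, w) \<in> F"
    using linear_relation_add[OF lin z(2)] by fastforce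
qed

text \<open>This gives uniqueness, since the right-hand side depends on \<open>F\<close> only
  through its ranges and domain. For the harder inclusion, any value \<open>c\<close> at
  \<open>a\<close> is compared with the candidate \<open>b\<close>: the difference
  \<open>b - c\<close> lies in both ranges, so it is multivalued and can be added to
  \<open>c\<close>.\<close>

lemma idempotent_eq_P_rel:
  assumes F: "idempotent_linear_relation F"
  shows "F = P_rel (Range F) (Range (id_minus_rel F)) \<inter> (Domain F \<times> UNIV)"
proof (intro set_eqI iffI; clarify)
  fix a b assume "(a, b) \<in> F"
  then show "(a, b) \<in> P_rel (Range F) (Range (id_minus_rel F)) \<inter> (Domain F \<times> UNIV)"
    by (auto simp: mem_P_rel_iff Range_id_minus_rel_iff intro!: exI[of _ a])
next
  have lin: "linear_relation F"
    using F by (simp add: idempotent_linear_relation_def)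
  fix a b c
  assume "(a, b) \<in> P_rel (Range F) (Range (id_minus_rel F))" and c: "(a, c) \<in> F"
  then obtain u v where u: "(u, b) \<in> F" and v: "(v, v - (a - b)) \<in> F"
    by (auto simp: mem_P_rel_iff Range_id_minus_rel_iff)
  have "(u - a, b - c) \<in> F"
    using linear_relation_diff[OF lin u c] .
  \<comment> \<open>This exhibits \<open>b - c = (a - b) * (-1) + (a - c)\<close> as a value of I -
    F, attained at \<open>a - v\<close>.\<close>
  moreover have "(a - v, a - v - (b - c)) \<in> F"
    using linear_relation_diff[OF lin c v] by (simp add: algebra_simps)
  ultimately have "(0, b - c) \<in> F"
    by (auto simp: idempotent_mul_eq[OF F] Range_id_minus_rel_iff)
  then show "(a, b) \<in> F"
    using linear_relation_add[OF lin c] by fastforce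
qed

text \<open>The intersection of the ranges is the multivalued part of \<open>F\<close>. Modulo that
  part, an element of \<open>Range F\<close> is a fixed point and so lies in the domain; conversely
  a domain element splits as \<open>a = b + (a - b)\<close> with
  \<open>(a, b) \<in> F\<close>.\<close>

lemma idempotent_imp_sum_eq:
  assumes F: "idempotent_linear_relation F"
  shows "(Range F \<inter> Range (id_minus_rel F)) + Domain F = Range F + Range (id_minus_rel F)"
    (is "(?X \<inter> ?Y) + ?Z = ?X + ?Y")
proof
  have lin: "linear_relation F"
    using F by (simp add: idempotent_linear_relation_def)
  show "(?X \<inter> ?Y) + ?Z \<subseteq> ?X + ?Y"
  proof
    fix s assume "s \<in> (?X \<inter> ?Y) + ?Z"
    then obtain w a b where s: "s = w + a" and w: "(0, w) \<in> F" and a: "(a, b) \<in> F"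
      by (auto simp: idempotent_mul_eq[OF F] elim!: set_plus_elim)
    have "w + b \<in> ?X"
      using linear_relation_add[OF lin w a] by auto
    moreover have "a - b \<in> ?Y"
      using a by (auto simp: Range_id_minus_rel_iff intro!: exI[of _ a])
    ultimately have "(w + b) + (a - b) \<in> ?X + ?Y"
      by (rule set_plus_intro)
    then show "s \<in> ?X + ?Y"
      by (simp add: s algebra_simps)
  qed
  show "?X + ?Y \<subseteq> (?X \<inter> ?Y) + ?Z"
  proof
    fix s assume "s \<in> ?X + ?Y"
    then obtain x y where s: "s = x + y" and "x \<in> ?X" and "y \<in> ?Y"
      by (rule set_plus_elim)
    then obtain u a where x: "(u, x) \<in> F" and a: "(a, a - y) \<in> F"
      unfolding Range_id_minus_rel_iff by blast
    \<comment> \<open>Write \<open>s = (x - (a - y)) + a\<close>: the first summand lies in the range of \<open>F\<close>.\<close>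
    have "(u - a, x - (a - y)) \<in> F"
      using linear_relation_diff[OF lin x a] .
    then obtain z where z: "(z, z) \<in> F" "(0, x - (a - y) - z) \<in> F"
      using idempotent_range_decomp[OF F] by blast
    have "z + a \<in> ?Z"
      using linear_relation_add[OF lin z(1) a] by auto
    with z(2) have "(x - (a - y) - z) + (z + a) \<in> (?X \<inter> ?Y) + ?Z"
      unfolding idempotent_mul_eq[OF F] by (rule set_plus_intro)
    then show "s \<in> (?X \<inter> ?Y) + ?Z"
      by (simp add: s algebra_simps)
  qed
qed

section \<open>Sums and intersections of three subspaces\<close>

text \<open>Forward, this is the modular law for \<open>X \<inter> Y \<subseteq> X\<close>, applied
  inside \<open>(X \<inter> Y) + Z\<close>, which contains \<open>X\<close>. Backward, the
  decomposition of \<open>X\<close> is substituted into \<open>X + Z\<close>, and \<open>Z\<close>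
  absorbs \<open>X \<inter> Z\<close>.\<close>

lemma sum_eq_iff_decomp:
  assumes X: "complex_vector.subspace X"
    and Y: "complex_vector.subspace Y"
    and Z: "complex_vector.subspace Z"
  shows "(X \<inter> Y) + Z = X + Y \<longleftrightarrow> X = (X \<inter> Y) + (X \<inter> Z) \<and> X + Y = X + Z"
proof
  have XX: "X + X = X"
  proof
    show "X + X \<subseteq> X"
      by (auto elim!: set_plus_elim intro: complex_vector.subspace_add[OF X])
    show "X \<subseteq> X + X"
      by (rule set_zero_plus2) (rule complex_vector.subspace_0[OF X])
  qed
  have XZZ: "(X \<inter> Z) + Z = Z"
  proof
    show "(X \<inter> Z) + Z \<subseteq> Z"
      by (auto elim!: set_plus_elim intro: complex_vector.subspace_add[OF Z])
    show "Z \<subseteq> (X \<inter> Z) + Z"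
      by (rule set_zero_plus2) (simp add: complex_vector.subspace_0 X Z)
  qed
  {
    assume eq: "(X \<inter> Y) + Z = X + Y"
    have "X \<subseteq> (X \<inter> Y) + (X \<inter> Z)"
    proof
      fix x assume x: "x \<in> X"
      have "x \<in> (X \<inter> Y) + Z"
        using set_plus_intro[OF x complex_vector.subspace_0[OF Y]] by (simp add: eq)
      then obtain w z where wz: "x = w + z" "w \<in> X" "w \<in> Y" "z \<in> Z"
        by (auto elim!: set_plus_elim)
      moreover have "z \<in> X"
        using complex_vector.subspace_diff[OF X x wz(2)] by (simp add: wz(1))
      ultimately show "x \<in> (X \<inter> Y) + (X \<inter> Z)"
        by (auto intro!: set_plus_intro)
    qed
    moreover have "(X \<inter> Y) + (X \<inter> Z) \<subseteq> X + X"
      by (rule set_plus_mono2) auto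
    moreover have "X + Z = X + Y"
    proof
      \<comment> \<open>Enlarging \<open>Z\<close> by \<open>X \<inter> Y\<close> makes the
        hypothesis applicable; the extra \<open>X\<close> is then absorbed.\<close>
      have "X + Z \<subseteq> X + ((X \<inter> Y) + Z)"
        by (intro set_plus_mono2 set_zero_plus2) (simp_all add: complex_vector.subspace_0 X Y)
      also have "\<dots> = X + Y"
        by (simp add: eq XX flip: add.assoc)
      finally show "X + Z \<subseteq> X + Y" .
      show "X + Y \<subseteq> X + Z"
        unfolding eq[symmetric] by (rule set_plus_mono2) auto
    qed
    ultimately show "X = (X \<inter> Y) + (X \<inter> Z) \<and> X + Y = X + Z"
      unfolding XX by blast
  }
  assume decomp: "X = (X \<inter> Y) + (X \<inter> Z) \<and> X + Y = X + Z"
  then have "X + Y = ((X \<inter> Y) + (X \<inter> Z)) + Z"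
    by simp
  then show "(X \<inter> Y) + Z = X + Y"
    by (simp add: XZZ add.assoc)
qed

section \<open>Construction of the idempotent from three subspaces\<close>

text \<open>Both inclusions in \<open>eq\<close> matter:
  \<open>X + Y \<subseteq> (X \<inter> Y) + Z\<close> supplies enough points of \<open>Z\<close> to
  reach all of \<open>X\<close> and \<open>Y\<close>, while \<open>Z \<subseteq> X + Y\<close> makes
  every point of \<open>Z\<close> a domain point.\<close>

lemma P_rel_restrict_idempotent:
  assumes X: "complex_vector.subspace X"
    and Y: "complex_vector.subspace Y"
    and Z: "complex_vector.subspace Z"
    and eq: "(X \<inter> Y) + Z = X + Y"
  defines "F \<equiv> P_rel X Y \<inter> (Z \<times> UNIV)"
  shows "idempotent_linear_relation F"
    and "Range F = X" and "Range (id_minus_rel F) = Y" and "Domain F = Z"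
proof -
  have F_iff: "(a, b) \<in> F \<longleftrightarrow> b \<in> X \<and> a - b \<in> Y \<and> a \<in> Z" for a b
    by (auto simp: F_def mem_P_rel_iff)
  note neg = complex_vector.subspace_neg[OF X] complex_vector.subspace_neg[OF Y]
  have decomp: "\<exists>w\<in>X \<inter> Y. \<exists>z\<in>Z. s = w + z" if "s \<in> X + Y" for s
    using that unfolding eq[symmetric] by (auto elim!: set_plus_elim)
  \<comment> \<open>Besides giving the range, this provides the intermediate point for idempotence,
    which is why \<open>z \<in> X\<close> is recorded.\<close>
  have X_decomp: "\<exists>z. (z, x) \<in> F \<and> z \<in> X \<and> x - z \<in> Y" if x: "x \<in> X" for x
  proof -
    have "x \<in> X + Y"
      using set_plus_intro[OF x complex_vector.subspace_0[OF Y]] by simp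
    then obtain w z where wz: "w \<in> X" "w \<in> Y" "z \<in> Z" "x = w + z"
      using decomp by blast
    have "z \<in> X"
      using complex_vector.subspace_diff[OF X x wz(1)] by (simp add: wz(4))
    then show ?thesis
      using wz x neg by (intro exI[of _ z]) (auto simp: F_iff)
  qed
  have "linear_relation F"
    using linear_relation_P_rel[OF X Y] subspace_Times_UNIV[OF Z]
    unfolding F_def linear_relation_def by (rule complex_vector.subspace_inter)
  moreover have "F O F = F"
  proof (intro set_eqI iffI; clarify)
    fix a b c assume "(a, b) \<in> F" "(b, c) \<in> F"
    then have "c \<in> X" "a - c \<in> Y" "a \<in> Z"
      using complex_vector.subspace_add[OF Y, of "a - b" "b - c"] by (auto simp: F_iff)
    then show "(a, c) \<in> F" by (simp add: F_iff)
  next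
    fix a b assume ab: "(a, b) \<in> F"
    then obtain z where z: "(z, b) \<in> F" "z \<in> X" "b - z \<in> Y"
      using X_decomp by (auto simp: F_iff)
    \<comment> \<open>Together with \<open>z \<in> X\<close> this gives
      \<open>(a, z) \<in> F\<close>, so \<open>(a, b)\<close> factors through
      \<open>z\<close>.\<close>
    moreover have "a - z \<in> Y"
      using complex_vector.subspace_add[OF Y, of "a - b" "b - z"] ab z by (simp add: F_iff)
    ultimately show "(a, b) \<in> F O F"
      using ab by (auto simp: F_iff)
  qed
  ultimately show "idempotent_linear_relation F"
    by (simp add: idempotent_linear_relation_def rel_product_def)
  show "Range F = X"
    using X_decomp F_iff by blast
  show "Range (id_minus_rel F) = Y"
  proof (intro set_eqI iffI)
    fix y assume y: "y \<in> Y"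
    have "y \<in> X + Y"
      using set_plus_intro[OF complex_vector.subspace_0[OF X] y] by simp
    then obtain w z where "w \<in> X" "z \<in> Z" "y = w + z"
      using decomp by blast
    \<comment> \<open>Here \<open>z - y = - w\<close> lies in \<open>X\<close>, and the difference
      of the two components is \<open>y\<close>.\<close>
    then have "(z, z - y) \<in> F"
      using y neg by (auto simp: F_iff add.commute)
    then show "y \<in> Range (id_minus_rel F)"
      by (auto simp: Range_id_minus_rel_iff)
  qed (auto simp: Range_id_minus_rel_iff F_iff)
  show "Domain F = Z"
  proof (intro set_eqI iffI)
    fix z assume z: "z \<in> Z"
    have "0 \<in> X \<inter> Y"
      by (simp add: complex_vector.subspace_0 X Y)
    then have "z \<in> X + Y"
      using set_plus_intro[of 0 "X \<inter> Y" z Z] z by (simp add: eq)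
    then obtain x y where "x \<in> X" "y \<in> Y" "z = x + y"
      by (auto elim!: set_plus_elim)
    then have "(z, x) \<in> F"
      using z by (simp add: F_iff)
    then show "z \<in> Domain F" by blast
  qed (auto simp: F_iff)
qed

theorem proposition4p10:
  fixes X Y Z :: "'a::separable_complex_hilbert_space set"
  assumes "complex_vector.subspace X"
    and "complex_vector.subspace Y"
    and "complex_vector.subspace Z"
  shows "((\<exists>F. idempotent_linear_relation F \<and>
             X = Range F \<and> Y = Range (id_minus_rel F) \<and> Z = Domain F)
           \<longleftrightarrow> (X \<inter> Y) + Z = X + Y)
       \<and> ((X \<inter> Y) + Z = X + Y
           \<longleftrightarrow> X = (X \<inter> Y) + (X \<inter> Z) \<and> X + Y = X + Z)
       \<and> ((X \<inter> Y) + Z = X + Y \<longrightarrow>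
           (let F\<^sub>0 = P_rel X Y \<inter> (Z \<times> UNIV) in
             (idempotent_linear_relation F\<^sub>0 \<and>
              X = Range F\<^sub>0 \<and> Y = Range (id_minus_rel F\<^sub>0) \<and> Z = Domain F\<^sub>0) \<and>
             (\<forall>F. idempotent_linear_relation F \<and>
                  X = Range F \<and> Y = Range (id_minus_rel F) \<and> Z = Domain F
                  \<longrightarrow> F = F\<^sub>0)))"
proof (intro conjI impI)
  note F\<^sub>0 = P_rel_restrict_idempotent[OF assms]
  show "(\<exists>F. idempotent_linear_relation F \<and>
             X = Range F \<and> Y = Range (id_minus_rel F) \<and> Z = Domain F)
           \<longleftrightarrow> (X \<inter> Y) + Z = X + Y"
    using idempotent_imp_sum_eq F\<^sub>0 by metis
  show "(X \<inter> Y) + Z = X + Y \<longleftrightarrow> X = (X \<inter> Y) + (X \<inter> Z) \<and> X + Y = X + Z"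
    by (rule sum_eq_iff_decomp[OF assms])
  assume "(X \<inter> Y) + Z = X + Y"
  from F\<^sub>0[OF this] show "let F\<^sub>0 = P_rel X Y \<inter> (Z \<times> UNIV) in
             (idempotent_linear_relation F\<^sub>0 \<and>
              X = Range F\<^sub>0 \<and> Y = Range (id_minus_rel F\<^sub>0) \<and> Z = Domain F\<^sub>0) \<and>
             (\<forall>F. idempotent_linear_relation F \<and>
                  X = Range F \<and> Y = Range (id_minus_rel F) \<and> Z = Domain F
                  \<longrightarrow> F = F\<^sub>0)"
    \<comment> \<open>Any competitor has the same ranges and domain, so the formula for idempotents
      identifies it with \<open>F\<^sub>0\<close>.\<close>
    unfolding Let_def using idempotent_eq_P_rel by metis
qed

end
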